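(* Let $H\in\mathbb{R}^{n\times n}$ be symmetric with positive diagonal, $D=\operatorname{diag}(H_{11},\dots,H_{nn})$, $A=D^{-1}|H-D|$ (entrywise absolute value), and $\theta_w(H)=\max_i (Aw)_i/w_i$ for $w\in\mathbb{R}^n_{>0}$. Then $$\theta_{\rm opt}(H):=\min_{w>0}\theta_w(H)=\rho(A),$$ and the minimum is attained, including when $A$ is reducible. The symmetric matrix $S=D^{-1/2}|H-D|D^{-1/2}$ is similar to $A$. If on each connected component of the graph on $\{1,\dots,n\}$ with edges $\{i,j\}$, $i\ne j$, $H_{ij}\ne0$, one chooses a positive eigenvector for the largest algebraic eigenvalue of the corresponding diagonal block of $S$, lets $v\in\mathbb{R}^n_{>0}$ be the concatenation of these vectors, and puts $w=D^{-1/2}v$, then $w$ attains the minimum.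
   Context: $\rho$ denotes the spectral radius. Minimum is over all vectors $w$ with strictly positive components. "Largest algebraic eigenvalue" of a real symmetric matrix means its largest eigenvalue in the usual order of $\mathbb{R}$ (not the one of largest modulus). Isolated vertices form $1\times1$ zero blocks of $S$, for which any positive number is an eigenvector. *)

theory Defs
  imports
    "Jordan_Normal_Form.Spectral_Radius"
    "Jordan_Normal_Form.DL_Submatrix"
begin

definition diag_part :: "real mat \<Rightarrow> real mat" where
  "diag_part H = mat_diag (dim_row H) (\<lambda>i. H $$ (i, i))"

text \<open>The inverse \<open>D\<^sup>-\<^sup>1\<close> and the inverse square root \<open>D\<^sup>-\<^sup>1\<^sup>/\<^sup>2\<close> of \<open>D = diag_part H\<close>;
  they have this meaning when the diagonal of \<open>H\<close> is positive.\<close>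

definition diag_inv :: "real mat \<Rightarrow> real mat" where
  "diag_inv H = mat_diag (dim_row H) (\<lambda>i. inverse (H $$ (i, i)))"

definition diag_inv_sqrt :: "real mat \<Rightarrow> real mat" where
  "diag_inv_sqrt H = mat_diag (dim_row H) (\<lambda>i. inverse (sqrt (H $$ (i, i))))"

definition abs_offdiag :: "real mat \<Rightarrow> real mat" where
  "abs_offdiag H = map_mat abs (H - diag_part H)"

definition scaled_A :: "real mat \<Rightarrow> real mat" where
  "scaled_A H = diag_inv H * abs_offdiag H"

definition scaled_S :: "real mat \<Rightarrow> real mat" where
  "scaled_S H = diag_inv_sqrt H * abs_offdiag H * diag_inv_sqrt H"

definition pos_vecs :: "nat \<Rightarrow> real vec set" where
  "pos_vecs n = {w \<in> carrier_vec n. \<forall>i<n. 0 < w $ i}"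

definition theta :: "real vec \<Rightarrow> real mat \<Rightarrow> real" where
  "theta w H = (MAX i\<in>{..<dim_row H}. (scaled_A H *\<^sub>v w) $ i / w $ i)"

text \<open>An infimum here; that it is a minimum is part of what the theorem asserts.\<close>

definition theta_opt :: "real mat \<Rightarrow> real" where
  "theta_opt H = (INF w\<in>pos_vecs (dim_row H). theta w H)"

definition offdiag_edges :: "real mat \<Rightarrow> (nat \<times> nat) set" where
  "offdiag_edges H =
     {(i, j). i < dim_row H \<and> j < dim_row H \<and> i \<noteq> j \<and> H $$ (i, j) \<noteq> 0}"

text \<open>For symmetric \<open>H\<close> the edge relation is symmetric, so that its reflexive transitive closure
  is an equivalence relation on the vertices. Indices start at \<open>0\<close>.\<close>

definition components :: "real mat \<Rightarrow> nat set set" where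
  "components H =
     {..<dim_row H} // ((offdiag_edges H)\<^sup>* \<inter> {..<dim_row H} \<times> {..<dim_row H})"

text \<open>The entries of \<open>v\<close> with index in \<open>I\<close>, in increasing order of the index; this is the
  numbering that \<^const>\<open>submatrix\<close> uses for rows and columns.\<close>

definition subvector :: "'a vec \<Rightarrow> nat set \<Rightarrow> 'a vec" where
  "subvector v I = vec (card {i. i < dim_vec v \<and> i \<in> I}) (\<lambda>k. v $ pick I k)"

definition largest_eigenvalue :: "real mat \<Rightarrow> real" where
  "largest_eigenvalue B = Max (spectrum B)"

text \<open>\<open>v\<close> is a concatenation of positive eigenvectors, one for each component.\<close>

definition component_eigenvector :: "real mat \<Rightarrow> real vec \<Rightarrow> bool" where
  "component_eigenvector H v \<longleftrightarrow>
     v \<in> pos_vecs (dim_row H) \<and>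
     (\<forall>C\<in>components H.
        eigenvector (submatrix (scaled_S H) C C) (subvector v C)
          (largest_eigenvalue (submatrix (scaled_S H) C C)))"

end

theory Submission
  imports "HOL-Analysis.Function_Topology" Defs
begin

text \<open>Write \<open>\<rho>\<close> for the spectral radius of \<open>A = scaled_A H\<close>. The theorem is a sandwich
  \<open>theta w H \<le> \<rho> \<le> theta w' H\<close>, in which \<open>w'\<close> is any positive vector and \<open>w\<close> comes from
  positive eigenvectors of the diagonal blocks of \<open>S = scaled_S H\<close>.

  The upper estimate of \<open>\<rho>\<close> is the Collatz-Wielandt bound
  (\<open>spectral_radius_le_Collatz_Wielandt\<close>): for an eigenvector \<open>x\<close> of a nonnegative matrix, compare
  \<open>\<bar>x\<bar>\<close> with \<open>w'\<close> at an index where \<open>\<bar>x\<^sub>i\<bar> / w'\<^sub>i\<close> is largest.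

  For the other estimate let \<open>v\<close> be positive and restrict on every component \<open>C\<close> of the graph to an
  eigenvector of the block of \<open>S\<close> on \<open>C\<close>, with eigenvalue \<open>r\<^sub>C\<close>, and let \<open>w = D\<^sup>-\<^sup>1\<^sup>/\<^sup>2 v\<close>. Since \<open>A\<close>
  has no entries between different components, \<open>(A w)\<^sub>i = r\<^sub>C w\<^sub>i\<close> for \<open>i \<in> C\<close>, so \<open>theta w H\<close> is the
  largest of the \<open>r\<^sub>C\<close>; and \<open>r\<^sub>C\<close> is an eigenvalue of \<open>A\<close>, with the restriction of \<open>w\<close> to \<open>C\<close>
  extended by zero as eigenvector (\<open>component_eigenvalue\<close>). Hence \<open>theta w H \<le> \<rho>\<close>. Reducibility
  of \<open>A\<close> is harmless because components are treated separately.

  Such a \<open>v\<close> exists by Perron's theorem for symmetric irreducible nonnegative matrices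
  (\<open>irreducible_block_Perron\<close>), which has a variational proof. The quadratic form attains its
  maximum on the unit sphere at a nonnegative vector, because passing to absolute values does not
  decrease it. A maximizer is an eigenvector for the largest eigenvalue, and irreducibility forbids
  zero entries.\<close>

section \<open>Principal submatrices and index sums\<close>

lemma bij_betw_pick:
  assumes "finite C"
  shows "bij_betw (pick C) {0..<card C} C"
proof -
  have "inj_on (pick C) {0..<card C}"
    by (rule inj_onI) (metis atLeastLessThan_iff nat_neq_iff pick_mono_le)
  moreover have "pick C ` {0..<card C} \<subseteq> C"
    by (auto intro: pick_in_set_le)
  ultimately show ?thesis
    by (metis assms bij_betw_def card_atLeastLessThan card_image card_subset_eq diff_zero)
qed

text \<open>Translates blocks, which are renumbered by \<^const>\<open>pick\<close>, into sums over the original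
  indices. All further work on blocks is done with such sums, so that the numbering inside a block
  does not appear again.\<close>

lemma eigenvector_submatrix_iff:
  fixes M :: "'a :: comm_ring_1 mat"
  assumes M: "M \<in> carrier_mat n n" and v: "v \<in> carrier_vec n" and C: "C \<subseteq> {..<n}"
  shows "eigenvector (submatrix M C C) (subvector v C) k \<longleftrightarrow>
    (\<exists>i\<in>C. v $ i \<noteq> 0) \<and> (\<forall>i\<in>C. (\<Sum>j\<in>C. M $$ (i, j) * v $ j) = k * v $ i)"
proof -
  have fin: "finite C" using C finite_subset by blast
  have set: "{i. i < n \<and> i \<in> C} = C" using C by auto
  have bij: "bij_betw (pick C) {0..<card C} C" by (rule bij_betw_pick[OF fin])
  have img: "C = pick C ` {0..<card C}" using bij by (simp add: bij_betw_def)
  have dims: "dim_row (submatrix M C C) = card C" "dim_col (submatrix M C C) = card C"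
    "dim_vec (subvector v C) = card C"
    using M v set by (auto simp: dim_submatrix subvector_def)
  have sub: "subvector v C $ a = v $ pick C a" if "a < card C" for a
    using that v set by (auto simp: subvector_def)
  have row: "(submatrix M C C *\<^sub>v subvector v C) $ a = (\<Sum>j\<in>C. M $$ (pick C a, j) * v $ j)"
    if a: "a < card C" for a
  proof -
    have "(submatrix M C C *\<^sub>v subvector v C) $ a =
        (\<Sum>b\<in>{0..<card C}. submatrix M C C $$ (a, b) * subvector v C $ b)"
      using a by (simp add: dims scalar_prod_def)
    also have "\<dots> = (\<Sum>b\<in>{0..<card C}. M $$ (pick C a, pick C b) * v $ pick C b)"
      using a M set by (intro sum.cong) (auto simp: sub submatrix_index)
    also have "\<dots> = (\<Sum>j\<in>C. M $$ (pick C a, j) * v $ j)"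
      by (rule sum.reindex_bij_betw[OF bij])
    finally show ?thesis .
  qed
  have "subvector v C \<noteq> 0\<^sub>v (card C) \<longleftrightarrow> (\<exists>a<card C. v $ pick C a \<noteq> 0)"
    using dims sub by (auto simp: vec_eq_iff)
  also have "\<dots> \<longleftrightarrow> (\<exists>i\<in>C. v $ i \<noteq> 0)"
    by (subst (2) img) auto
  finally have nz: "subvector v C \<noteq> 0\<^sub>v (card C) \<longleftrightarrow> (\<exists>i\<in>C. v $ i \<noteq> 0)" .
  have carrier: "subvector v C \<in> carrier_vec (card C)"
    by (rule carrier_vecI) (rule dims(3))
  have "submatrix M C C *\<^sub>v subvector v C = k \<cdot>\<^sub>v subvector v C \<longleftrightarrow>
      (\<forall>a<card C. (\<Sum>j\<in>C. M $$ (pick C a, j) * v $ j) = k * v $ pick C a)"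
    using dims sub row by (auto simp: vec_eq_iff)
  also have "\<dots> \<longleftrightarrow> (\<forall>i\<in>C. (\<Sum>j\<in>C. M $$ (i, j) * v $ j) = k * v $ i)"
  proof -
    have "(\<forall>i\<in>C. P i) \<longleftrightarrow> (\<forall>a<card C. P (pick C a))" for P
      by (subst img) auto
    then show ?thesis by simp
  qed
  finally show ?thesis
    unfolding eigenvector_def dims(1) using nz carrier by blast
qed

text \<open>With the previous lemma this describes every eigenvector of a block, as is needed to
  bound all of its eigenvalues.\<close>

lemma subvector_surj:
  assumes C: "C \<subseteq> {..<n}" and u: "u \<in> carrier_vec (card C)"
  obtains v where "v \<in> carrier_vec n" "subvector v C = u"
proof -
  have set: "{i. i < n \<and> i \<in> C} = C" using C by auto
  let ?v = "vec n (\<lambda>i. u $ card {a\<in>C. a < i})"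
  have "pick C a < n" "card {b\<in>C. b < pick C a} = a" if "a < card C" for a
    using that C pick_in_set_le[OF that] card_pick_le[OF that] by auto
  then have "subvector ?v C = u"
    using u set by (intro eq_vecI) (auto simp: subvector_def)
  then show thesis using that[of ?v] by simp
qed

section \<open>Perron vectors of symmetric nonnegative arrays\<close>

definition quad_form :: "'i set \<Rightarrow> ('i \<Rightarrow> 'i \<Rightarrow> real) \<Rightarrow> ('i \<Rightarrow> real) \<Rightarrow> real" where
  "quad_form C S x = (\<Sum>i\<in>C. \<Sum>j\<in>C. x i * S i j * x j)"

text \<open>The maximum is taken over nonnegative vectors only: this puts the normalized vectors into
  the cube with side \<open>[0, 1]\<close>, which is compact as a product, and makes the maximizer nonnegative
  from the start.\<close>

lemma quad_form_max_on_nonneg: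
  fixes S :: "'i \<Rightarrow> 'i \<Rightarrow> real"
  assumes fin: "finite C" and ne: "C \<noteq> {}"
  obtains x where "\<And>i. i \<in> C \<Longrightarrow> 0 \<le> x i" "(\<Sum>i\<in>C. (x i)\<^sup>2) = 1"
    "\<And>y. (\<And>i. i \<in> C \<Longrightarrow> 0 \<le> y i) \<Longrightarrow>
      quad_form C S y \<le> quad_form C S x * (\<Sum>i\<in>C. (y i)\<^sup>2)"
proof -
  (* Entries outside C are fixed to 0: B has to be a product of compact sets over the whole
     index type, which may be infinite. *)
  define B :: "('i \<Rightarrow> real) set" where
    "B = PiE UNIV (\<lambda>i. if i \<in> C then {0..1} else {0})"
  define K where "K = B \<inter> {x. (\<Sum>i\<in>C. (x i)\<^sup>2) = 1}"
  have coord: "continuous_on UNIV (\<lambda>x :: 'i \<Rightarrow> real. x i)" for i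
    by (rule continuous_on_product_coordinates)
  have cont: "continuous_on UNIV (quad_form C S)"
    unfolding quad_form_def by (intro continuous_intros coord)
  have "compactin (product_topology (\<lambda>i. euclidean) UNIV) B"
    unfolding B_def by (subst compactin_PiE) auto
  then have "compact B"
    by (simp add: euclidean_product_topology compactin_euclidean_iff)
  moreover have "closed {x :: 'i \<Rightarrow> real. (\<Sum>i\<in>C. (x i)\<^sup>2) = 1}"
    by (intro closed_Collect_eq continuous_intros coord)
  ultimately have comp: "compact K"
    unfolding K_def by (rule compact_Int_closed)
  obtain c where c: "c \<in> C" using ne by blast
  have "(\<lambda>i. if i = c then 1 else 0) \<in> K"
    using c fin by (auto simp: K_def B_def if_distrib[of "\<lambda>t. t\<^sup>2"] cong: if_cong)
  then have "K \<noteq> {}" by blast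
  then obtain x where x: "x \<in> K" and max: "\<And>y. y \<in> K \<Longrightarrow> quad_form C S y \<le> quad_form C S x"
    using continuous_attains_sup[OF comp _ continuous_on_subset[OF cont subset_UNIV]] by blast
  (* Both sides are homogeneous of degree two, so it suffices to normalize y. *)
  have "quad_form C S y \<le> quad_form C S x * (\<Sum>i\<in>C. (y i)\<^sup>2)"
    if y: "\<And>i. i \<in> C \<Longrightarrow> 0 \<le> y i" for y
  proof (cases "(\<Sum>i\<in>C. (y i)\<^sup>2) = 0")
    case True
    then have "\<forall>i\<in>C. y i = 0" using fin by (simp add: sum_nonneg_eq_0_iff)
    then show ?thesis using True by (simp add: quad_form_def)
  next
    case False
    define N where "N = (\<Sum>i\<in>C. (y i)\<^sup>2)"
    have N: "0 < N" using False unfolding N_def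
      by (metis less_eq_real_def sum_nonneg zero_le_power2)
    define z where "z = (\<lambda>i. if i \<in> C then y i / sqrt N else 0)"
    have one: "(\<Sum>i\<in>C. (z i)\<^sup>2) = 1"
    proof -
      have "(\<Sum>i\<in>C. (z i)\<^sup>2) = (\<Sum>i\<in>C. (y i)\<^sup>2 / N)"
        using N by (intro sum.cong) (auto simp: z_def power_divide)
      also have "\<dots> = 1" using N by (simp add: N_def flip: sum_divide_distrib)
      finally show ?thesis .
    qed
    have "z i \<le> 1" if "i \<in> C" for i
    proof -
      have "(z i)\<^sup>2 \<le> 1" using member_le_sum[OF that, of "\<lambda>i. (z i)\<^sup>2"] fin one by simp
      then show ?thesis by (simp add: power2_le_iff_abs_le abs_le_iff abs_square_le_1)
    qed
    moreover have "0 \<le> z i" for i using y N by (simp add: z_def)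
    ultimately have "z \<in> K" using one by (auto simp: K_def B_def) (simp add: z_def)
    then have "quad_form C S z \<le> quad_form C S x" by (rule max)
    moreover have "quad_form C S z = quad_form C S y / N"
    proof -
      have "quad_form C S z = (\<Sum>i\<in>C. \<Sum>j\<in>C. y i * S i j * y j / N)"
        unfolding quad_form_def using N by (intro sum.cong) (auto simp: z_def)
      then show ?thesis by (simp add: quad_form_def flip: sum_divide_distrib)
    qed
    ultimately show ?thesis using N by (simp add: N_def field_simps)
  qed
  moreover have "0 \<le> x i" if "i \<in> C" for i
    using x that unfolding K_def B_def PiE_def Pi_def by (auto dest: spec[of _ i])
  moreover have "(\<Sum>i\<in>C. (x i)\<^sup>2) = 1" using x by (simp add: K_def)
  ultimately show thesis using that by blast
qed

text \<open>The first-order condition at a minimum. The value \<open>t = - b / (\<bar>a\<bar> + 1)\<close> makes the linear term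
  dominate the quadratic one.\<close>

lemma linear_coeff_zero:
  fixes a b :: real
  assumes "\<And>t. 0 \<le> 2 * t * b + t\<^sup>2 * a"
  shows "b = 0"
proof (rule ccontr)
  assume "b \<noteq> 0"
  define t where "t = - b / (\<bar>a\<bar> + 1)"
  have b: "b = - (t * (\<bar>a\<bar> + 1))" by (simp add: t_def)
  have "t \<noteq> 0" using \<open>b \<noteq> 0\<close> b by auto
  have "2 * t * b + t\<^sup>2 * a = t\<^sup>2 * (a - 2 * (\<bar>a\<bar> + 1))"
    by (subst b) (simp add: algebra_simps power2_eq_square)
  also have "\<dots> < 0"
    using \<open>t \<noteq> 0\<close> by (intro mult_pos_neg) auto
  finally have "2 * t * b + t\<^sup>2 * a < 0" .
  then show False using assms[of t] by simp
qed

lemma quad_form_add_unit: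
  assumes fin: "finite C" and i: "i \<in> C" and sym: "\<And>i j. i \<in> C \<Longrightarrow> j \<in> C \<Longrightarrow> S i j = S j i"
  shows "quad_form C S (\<lambda>j. x j + (if j = i then t else 0)) =
    quad_form C S x + 2 * t * (\<Sum>j\<in>C. S i j * x j) + t\<^sup>2 * S i i"
proof -
  have "quad_form C S (\<lambda>j. x j + (if j = i then t else 0)) =
      (\<Sum>k\<in>C. \<Sum>j\<in>C. x k * S k j * x j + (if k = i then t * S i j * x j else 0)
        + (if j = i then x k * S k i * t else 0) + (if k = i then if j = i then t\<^sup>2 * S i i else 0 else 0))"
    unfolding quad_form_def
    by (intro sum.cong) (auto simp: algebra_simps power2_eq_square)
  also have "\<dots> = quad_form C S x + (\<Sum>j\<in>C. t * S i j * x j) + (\<Sum>k\<in>C. x k * S k i * t) + t\<^sup>2 * S i i"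
  proof -
    have "(\<Sum>k\<in>C. \<Sum>j\<in>C. if k = i then f j else (0::real)) = (\<Sum>j\<in>C. f j)" for f
      using fin i by (subst sum.swap) simp
    then show ?thesis using fin i by (simp add: sum.distrib quad_form_def)
  qed
  also have "(\<Sum>k\<in>C. x k * S k i * t) = t * (\<Sum>j\<in>C. S i j * x j)"
    unfolding sum_distrib_left using i sym by (intro sum.cong) auto
  also have "(\<Sum>j\<in>C. t * S i j * x j) = t * (\<Sum>j\<in>C. S i j * x j)"
    by (simp add: sum_distrib_left mult.assoc)
  finally show ?thesis by simp
qed

text \<open>For nonnegative \<open>S\<close>, replacing \<open>y\<close> by \<open>\<bar>y\<bar>\<close> does not decrease the quadratic form, so the
  maximum over nonnegative vectors bounds it everywhere. Thus \<open>r \<bar>y\<bar>\<^sup>2 - quad_form C S y\<close> is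
  nonnegative and vanishes at the maximizer \<open>x\<close>. Its derivative at \<open>x\<close> in each coordinate direction
  is then zero, and this is the eigenvector equation.\<close>

lemma symmetric_nonneg_top_eigenvector:
  fixes S :: "'i \<Rightarrow> 'i \<Rightarrow> real"
  assumes fin: "finite C" and ne: "C \<noteq> {}"
    and sym: "\<And>i j. i \<in> C \<Longrightarrow> j \<in> C \<Longrightarrow> S i j = S j i"
    and nonneg: "\<And>i j. i \<in> C \<Longrightarrow> j \<in> C \<Longrightarrow> 0 \<le> S i j"
  obtains x r where "\<And>i. i \<in> C \<Longrightarrow> 0 \<le> x i" "\<exists>i\<in>C. x i \<noteq> 0"
    "\<And>i. i \<in> C \<Longrightarrow> (\<Sum>j\<in>C. S i j * x j) = r * x i"
    "\<And>y. quad_form C S y \<le> r * (\<Sum>i\<in>C. (y i)\<^sup>2)"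
proof -
  obtain x where x0: "\<And>i. i \<in> C \<Longrightarrow> 0 \<le> x i" and x1: "(\<Sum>i\<in>C. (x i)\<^sup>2) = 1"
    and max: "\<And>y. (\<And>i. i \<in> C \<Longrightarrow> 0 \<le> y i) \<Longrightarrow>
      quad_form C S y \<le> quad_form C S x * (\<Sum>i\<in>C. (y i)\<^sup>2)"
    using quad_form_max_on_nonneg[OF fin ne] by blast
  define r where "r = quad_form C S x"
  have bound: "quad_form C S y \<le> r * (\<Sum>i\<in>C. (y i)\<^sup>2)" for y
  proof -
    have "quad_form C S y \<le> quad_form C S (\<lambda>i. \<bar>y i\<bar>)"
      unfolding quad_form_def
    proof (intro sum_mono)
      fix i j assume "i \<in> C" "j \<in> C"
      then have "\<bar>y i * S i j * y j\<bar> = \<bar>y i\<bar> * S i j * \<bar>y j\<bar>"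
        using nonneg by (simp add: abs_mult)
      then show "y i * S i j * y j \<le> \<bar>y i\<bar> * S i j * \<bar>y j\<bar>" by linarith
    qed
    also have "\<dots> \<le> r * (\<Sum>i\<in>C. (\<bar>y i\<bar>)\<^sup>2)"
      unfolding r_def by (rule max) simp
    finally show ?thesis by simp
  qed
  have "(\<Sum>j\<in>C. S i j * x j) = r * x i" if i: "i \<in> C" for i
  proof -
    have "r * x i - (\<Sum>j\<in>C. S i j * x j) = 0"
    proof (rule linear_coeff_zero)
      fix t
      have "(\<Sum>j\<in>C. (x j + (if j = i then t else 0))\<^sup>2) =
          (\<Sum>j\<in>C. (x j)\<^sup>2 + (if j = i then 2 * t * x i + t\<^sup>2 else 0))"
        by (intro sum.cong) (auto simp: power2_eq_square algebra_simps)
      also have "\<dots> = 1 + 2 * t * x i + t\<^sup>2"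
        using i fin x1 by (simp add: sum.distrib)
      finally have norm: "(\<Sum>j\<in>C. (x j + (if j = i then t else 0))\<^sup>2) = 1 + 2 * t * x i + t\<^sup>2" .
      have "quad_form C S x + 2 * t * (\<Sum>j\<in>C. S i j * x j) + t\<^sup>2 * S i i
          \<le> r * (1 + 2 * t * x i + t\<^sup>2)"
        using bound[of "\<lambda>j. x j + (if j = i then t else 0)"]
          quad_form_add_unit[of C i S x t] fin i sym
        unfolding norm by simp
      then show "0 \<le> 2 * t * (r * x i - (\<Sum>j\<in>C. S i j * x j)) + t\<^sup>2 * (r - S i i)"
        unfolding r_def[symmetric] by (simp add: algebra_simps)
    qed
    then show ?thesis by simp
  qed
  moreover have "\<exists>i\<in>C. x i \<noteq> 0"
    using x1 by (metis (mono_tags, lifting) sum.neutral zero_neq_one zero_power2)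
  ultimately show thesis using that x0 bound by blast
qed

text \<open>In the row of a zero entry of the eigenvector all summands are nonnegative and add up to
  zero, so neighbours of zeros are zeros; irreducibility spreads them over all of \<open>C\<close>.\<close>

lemma nonneg_eigenvector_pos:
  fixes S :: "'i \<Rightarrow> 'i \<Rightarrow> real"
  assumes fin: "finite C"
    and nonneg: "\<And>i j. i \<in> C \<Longrightarrow> j \<in> C \<Longrightarrow> 0 \<le> S i j"
    and irred: "\<And>Z. Z \<subseteq> C \<Longrightarrow> Z \<noteq> {} \<Longrightarrow> Z \<noteq> C \<Longrightarrow> \<exists>i\<in>Z. \<exists>j\<in>C - Z. S i j \<noteq> 0"
    and x0: "\<And>i. i \<in> C \<Longrightarrow> 0 \<le> x i" and xn: "\<exists>i\<in>C. x i \<noteq> 0"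
    and ev: "\<And>i. i \<in> C \<Longrightarrow> (\<Sum>j\<in>C. S i j * x j) = r * x i"
    and i: "i \<in> C"
  shows "0 < x i"
proof (rule ccontr)
  assume "\<not> 0 < x i"
  define Z where "Z = {i\<in>C. x i = 0}"
  have "i \<in> Z" using \<open>\<not> 0 < x i\<close> x0[OF i] i by (simp add: Z_def)
  moreover have "Z \<noteq> C" "Z \<subseteq> C" using xn by (auto simp: Z_def)
  ultimately obtain k j where k: "k \<in> Z" and j: "j \<in> C - Z" and kj: "S k j \<noteq> 0"
    using irred by blast
  have kC: "k \<in> C" and xk: "x k = 0" using k by (auto simp: Z_def)
  have "(\<Sum>j\<in>C. S k j * x j) = 0" using ev[OF kC] xk by simp
  then have "S k j * x j = 0"
    using sum_nonneg_eq_0_iff[OF fin, of "\<lambda>j. S k j * x j"] nonneg[OF kC] x0 j by auto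
  then show False using kj j by (auto simp: Z_def)
qed

text \<open>An eigenvalue \<open>k\<close> with eigenvector \<open>v\<close> makes the quadratic form at \<open>v\<close> equal to \<open>k \<bar>v\<bar>\<^sup>2\<close>. So the
  eigenvalue \<open>r\<close> obtained from the maximum of the form on the unit sphere is the largest one.\<close>

lemma irreducible_block_Perron:
  fixes M :: "real mat"
  assumes M: "M \<in> carrier_mat n n" and C: "C \<subseteq> {..<n}" and ne: "C \<noteq> {}"
    and sym: "\<And>i j. i \<in> C \<Longrightarrow> j \<in> C \<Longrightarrow> M $$ (i, j) = M $$ (j, i)"
    and nonneg: "\<And>i j. i \<in> C \<Longrightarrow> j \<in> C \<Longrightarrow> 0 \<le> M $$ (i, j)"
    and irred: "\<And>Z. Z \<subseteq> C \<Longrightarrow> Z \<noteq> {} \<Longrightarrow> Z \<noteq> C \<Longrightarrow> \<exists>i\<in>Z. \<exists>j\<in>C - Z. M $$ (i, j) \<noteq> 0"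
  obtains x where "\<And>i. i \<in> C \<Longrightarrow> 0 < x i"
    "\<And>i. i \<in> C \<Longrightarrow> (\<Sum>j\<in>C. M $$ (i, j) * x j) = largest_eigenvalue (submatrix M C C) * x i"
proof -
  have fin: "finite C" using C finite_subset by blast
  obtain x r where x0: "\<And>i. i \<in> C \<Longrightarrow> 0 \<le> x i" and xn: "\<exists>i\<in>C. x i \<noteq> 0"
    and ev: "\<And>i. i \<in> C \<Longrightarrow> (\<Sum>j\<in>C. M $$ (i, j) * x j) = r * x i"
    and bound: "\<And>y. quad_form C (\<lambda>i j. M $$ (i, j)) y \<le> r * (\<Sum>i\<in>C. (y i)\<^sup>2)"
    using symmetric_nonneg_top_eigenvector[of C "\<lambda>i j. M $$ (i, j)"] fin ne sym nonneg by blast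
  have pos: "0 < x i" if "i \<in> C" for i
    by (rule nonneg_eigenvector_pos[of C "\<lambda>i j. M $$ (i, j)" x r])
      (use fin nonneg irred x0 xn ev that in auto)
  have set: "{i. i < n \<and> i \<in> C} = C" using C by auto
  have cs: "submatrix M C C \<in> carrier_mat (card C) (card C)"
    using carrier_matD[OF M] by (intro carrier_matI) (simp_all add: dim_submatrix set)
  have "largest_eigenvalue (submatrix M C C) = r"
    unfolding largest_eigenvalue_def
  proof (rule Max_eqI)
    show "finite (spectrum (submatrix M C C))" by (rule card_finite_spectrum[OF cs])
    have vx: "vec n x $ i = x i" if "i \<in> C" for i using that C by auto
    have "(\<Sum>j\<in>C. M $$ (i, j) * vec n x $ j) = r * vec n x $ i" if "i \<in> C" for i
      using ev[OF that] vx that by simp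
    moreover have "\<exists>i\<in>C. vec n x $ i \<noteq> 0" using xn vx by auto
    ultimately have "eigenvector (submatrix M C C) (subvector (vec n x) C) r"
      by (subst eigenvector_submatrix_iff[OF M _ C]) auto
    then show "r \<in> spectrum (submatrix M C C)"
      by (auto simp: spectrum_def eigenvalue_def)
  next
    fix k assume "k \<in> spectrum (submatrix M C C)"
    then obtain u where u: "eigenvector (submatrix M C C) u k"
      by (auto simp: spectrum_def eigenvalue_def)
    then have "u \<in> carrier_vec (card C)" using cs by (auto simp: eigenvector_def)
    then obtain v where v: "v \<in> carrier_vec n" and "subvector v C = u"
      using subvector_surj[OF C] by blast
    with u have vn: "\<exists>i\<in>C. v $ i \<noteq> 0"
      and vk: "\<And>i. i \<in> C \<Longrightarrow> (\<Sum>j\<in>C. M $$ (i, j) * v $ j) = k * v $ i"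
      using eigenvector_submatrix_iff[OF M v C] by auto
    have "quad_form C (\<lambda>i j. M $$ (i, j)) (\<lambda>i. v $ i) = (\<Sum>i\<in>C. v $ i * (k * v $ i))"
      unfolding quad_form_def
      by (intro sum.cong refl) (simp add: sum_distrib_left mult.assoc flip: vk)
    also have "\<dots> = k * (\<Sum>i\<in>C. (v $ i)\<^sup>2)"
      by (simp add: sum_distrib_left power2_eq_square mult_ac)
    finally have "k * (\<Sum>i\<in>C. (v $ i)\<^sup>2) \<le> r * (\<Sum>i\<in>C. (v $ i)\<^sup>2)"
      using bound[of "\<lambda>i. v $ i"] by simp
    moreover have "0 < (\<Sum>i\<in>C. (v $ i)\<^sup>2)"
      using vn fin by (meson sum_pos2 zero_le_power2 zero_less_power2)
    ultimately show "k \<le> r" by simp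
  qed
  then show thesis using that pos ev by blast
qed

section \<open>Bounds on the spectral radius\<close>

text \<open>If \<open>A x = l x\<close> and \<open>q\<close> is the largest of the quotients \<open>\<bar>x\<^sub>i\<bar> / w\<^sub>i\<close>, attained at \<open>p\<close>, then
  \<open>\<bar>l\<bar> \<bar>x\<^sub>p\<bar> \<le> (A \<bar>x\<bar>)\<^sub>p \<le> q (A w)\<^sub>p \<le> q t w\<^sub>p = t \<bar>x\<^sub>p\<bar>\<close>.\<close>

lemma spectral_radius_le_Collatz_Wielandt:
  fixes A :: "real mat"
  assumes n: "0 < n" and A: "A \<in> carrier_mat n n"
    and nonneg: "\<And>i j. i < n \<Longrightarrow> j < n \<Longrightarrow> 0 \<le> A $$ (i, j)"
    and w: "w \<in> pos_vecs n" and t: "\<And>i. i < n \<Longrightarrow> (A *\<^sub>v w) $ i \<le> t * w $ i"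
  shows "spectral_radius (map_mat complex_of_real A) \<le> t"
proof -
  let ?A = "map_mat complex_of_real A"
  have cA: "?A \<in> carrier_mat n n" using A by simp
  obtain l where l: "eigenvalue ?A l" and sr: "spectral_radius ?A = norm l"
    using spectral_radius_mem_max(1)[OF cA n] by (auto simp: spectrum_def)
  obtain x where xc: "x \<in> carrier_vec n" and xn: "x \<noteq> 0\<^sub>v n" and ev: "?A *\<^sub>v x = l \<cdot>\<^sub>v x"
    using l A by (auto simp: eigenvalue_def eigenvector_def)
  have wpos: "0 < w $ i" if "i < n" for i using w that by (simp add: pos_vecs_def)
  have wc: "w \<in> carrier_vec n" using w by (simp add: pos_vecs_def)
  define q where "q i = norm (x $ i) / w $ i" for i
  have fin: "finite (q ` {..<n})" "q ` {..<n} \<noteq> {}" using n by auto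
  then have "Max (q ` {..<n}) \<in> q ` {..<n}" by (rule Max_in)
  then obtain p where p: "p < n" and qp: "q p = Max (q ` {..<n})" by auto
  have qmax: "q i \<le> q p" if "i < n" for i using that qp fin by simp
  obtain m where m: "m < n" "x $ m \<noteq> 0"
    using xn xc by (auto simp: vec_eq_iff)
  have "0 < q m" using m wpos by (simp add: q_def)
  then have qpos: "0 < q p" using qmax[OF m(1)] by linarith
  then have xp: "0 < norm (x $ p)" by (auto simp: q_def)
  have "norm l * norm (x $ p) = norm ((?A *\<^sub>v x) $ p)"
    using ev xc p by (simp add: norm_mult)
  also have "\<dots> = norm (\<Sum>j\<in>{0..<n}. complex_of_real (A $$ (p, j)) * x $ j)"
    using A xc p by (simp add: scalar_prod_def)
  also have "\<dots> \<le> (\<Sum>j\<in>{0..<n}. A $$ (p, j) * norm (x $ j))"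
    using nonneg[OF p] by (intro order.trans[OF norm_sum] sum_mono) (simp add: norm_mult)
  also have "\<dots> \<le> (\<Sum>j\<in>{0..<n}. A $$ (p, j) * (q p * w $ j))"
  proof (intro sum_mono mult_left_mono)
    fix j assume "j \<in> {0..<n}"
    then show "norm (x $ j) \<le> q p * w $ j" "0 \<le> A $$ (p, j)"
      using qmax[of j] wpos[of j] nonneg[OF p] by (auto simp: q_def divide_le_eq)
  qed
  also have "\<dots> = q p * (A *\<^sub>v w) $ p"
    using A wc p by (simp add: scalar_prod_def sum_distrib_left mult_ac)
  also have "\<dots> \<le> q p * (t * w $ p)"
    using t[OF p] qpos by simp
  also have "\<dots> = t * norm (x $ p)"
    using wpos[OF p] by (simp add: q_def)
  finally show ?thesis using xp sr by simp
qed

lemma eigenvalue_le_spectral_radius: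
  fixes A :: "real mat"
  assumes A: "A \<in> carrier_mat n n" and n: "0 < n" and k: "eigenvalue A k"
  shows "k \<le> spectral_radius (map_mat complex_of_real A)"
proof -
  have "eigenvalue (map_mat complex_of_real A) (complex_of_real k)"
    using of_real_hom.eigenvalue_hom[OF A k] .
  then have "norm (complex_of_real k) \<le> spectral_radius (map_mat complex_of_real A)"
    using A n by (intro spectral_radius_mem_max(2)[of _ n] imageI) (auto simp: spectrum_def)
  then show ?thesis by simp
qed


section \<open>The scaled matrices and the components of the graph\<close>

locale sym_pos_diag =
  fixes H :: "real mat" and n :: nat
  assumes n_pos: "0 < n"
    and H_carrier: "H \<in> carrier_mat n n"
    and H_sym: "transpose_mat H = H"
    and H_diag: "\<And>i. i < n \<Longrightarrow> 0 < H $$ (i, i)"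
begin

lemma dim_H [simp]: "dim_row H = n" "dim_col H = n"
  using H_carrier by auto

lemma H_swap: "i < n \<Longrightarrow> j < n \<Longrightarrow> H $$ (i, j) = H $$ (j, i)"
  by (metis H_sym dim_H index_transpose_mat(1))

lemma abs_offdiag_carrier: "abs_offdiag H \<in> carrier_mat n n"
  by (rule carrier_matI) (simp_all add: abs_offdiag_def diag_part_def mat_diag_def)

lemma abs_offdiag_entry:
  "i < n \<Longrightarrow> j < n \<Longrightarrow> abs_offdiag H $$ (i, j) = (if i = j then 0 else \<bar>H $$ (i, j)\<bar>)"
  by (auto simp: abs_offdiag_def diag_part_def mat_diag_def)

lemma scaled_A_carrier [simp]: "scaled_A H \<in> carrier_mat n n"
  unfolding scaled_A_def diag_inv_def dim_H mat_diag_mult_left[OF abs_offdiag_carrier] by simp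

lemma scaled_A_entry:
  "i < n \<Longrightarrow> j < n \<Longrightarrow> scaled_A H $$ (i, j) = (if i = j then 0 else \<bar>H $$ (i, j)\<bar> / H $$ (i, i))"
  unfolding scaled_A_def diag_inv_def dim_H mat_diag_mult_left[OF abs_offdiag_carrier]
  by (simp add: abs_offdiag_entry field_simps)

lemma scaled_S_eq: "scaled_S H = mat n n (\<lambda>(i, j).
  inverse (sqrt (H $$ (i, i))) * abs_offdiag H $$ (i, j) * inverse (sqrt (H $$ (j, j))))"
  unfolding scaled_S_def diag_inv_sqrt_def dim_H mat_diag_mult_left[OF abs_offdiag_carrier]
  by (subst mat_diag_mult_right[of _ n]) auto

lemma scaled_S_carrier [simp]: "scaled_S H \<in> carrier_mat n n"
  by (simp add: scaled_S_eq)

lemma dim_scaled [simp]: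
  "dim_row (scaled_A H) = n" "dim_col (scaled_A H) = n"
  "dim_row (scaled_S H) = n" "dim_col (scaled_S H) = n"
  using carrier_matD[OF scaled_A_carrier] carrier_matD[OF scaled_S_carrier] by simp_all

lemma scaled_S_entry:
  "i < n \<Longrightarrow> j < n \<Longrightarrow> scaled_S H $$ (i, j) =
    (if i = j then 0 else \<bar>H $$ (i, j)\<bar> / (sqrt (H $$ (i, i)) * sqrt (H $$ (j, j))))"
  by (simp add: scaled_S_eq abs_offdiag_entry field_simps)

lemma scaled_S_sym: "transpose_mat (scaled_S H) = scaled_S H"
proof (rule eq_matI)
  fix i j assume "i < dim_row (scaled_S H)" "j < dim_col (scaled_S H)"
  then have "i < n" "j < n" by simp_all
  then show "transpose_mat (scaled_S H) $$ (i, j) = scaled_S H $$ (i, j)"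
    using H_swap[of i j] by (simp add: scaled_S_entry mult.commute)
qed simp_all

lemma scaled_A_eq_scaled_S:
  assumes "i < n" "j < n"
  shows "scaled_A H $$ (i, j) = scaled_S H $$ (i, j) * sqrt (H $$ (j, j)) / sqrt (H $$ (i, i))"
  using H_diag[OF assms(1)] H_diag[OF assms(2)] assms
  by (simp add: scaled_A_entry scaled_S_entry field_simps)

lemma scaled_S_similar: "similar_mat (scaled_S H) (scaled_A H)"
proof -
  define P where "P = mat_diag n (\<lambda>i. sqrt (H $$ (i, i)))"
  define Q where "Q = mat_diag n (\<lambda>i. inverse (sqrt (H $$ (i, i))))"
  have "sqrt (H $$ (i, i)) \<noteq> 0" if "i < n" for i using H_diag[OF that] by simp
  then have "mat_diag n (\<lambda>i. sqrt (H $$ (i, i)) * inverse (sqrt (H $$ (i, i)))) = 1\<^sub>m n"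
    by (intro eq_matI) (auto simp: mat_diag_def)
  then have "P * Q = 1\<^sub>m n" "Q * P = 1\<^sub>m n"
    by (simp_all add: P_def Q_def mult.commute)
  moreover have "scaled_S H = P * scaled_A H * Q"
  proof -
    have "P * scaled_A H * Q = mat n n (\<lambda>(i, j).
        sqrt (H $$ (i, i)) * scaled_A H $$ (i, j) * inverse (sqrt (H $$ (j, j))))"
      unfolding P_def Q_def mat_diag_mult_left[OF scaled_A_carrier]
      by (subst mat_diag_mult_right[of _ n]) auto
    moreover have "scaled_S H $$ (i, j) =
        sqrt (H $$ (i, i)) * scaled_A H $$ (i, j) * inverse (sqrt (H $$ (j, j)))"
      if "i < n" "j < n" for i j
      using H_diag[OF that(1)] H_diag[OF that(2)] scaled_A_eq_scaled_S[OF that]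
      by (simp add: field_simps)
    ultimately show ?thesis by (intro eq_matI) auto
  qed
  ultimately have "similar_mat_wit (scaled_S H) (scaled_A H) P Q"
    by (rule similar_mat_witI) (simp_all add: P_def Q_def)
  then show ?thesis by (auto simp: similar_mat_def)
qed

lemma equiv_reachability: "equiv {..<n} ((offdiag_edges H)\<^sup>* \<inter> {..<n} \<times> {..<n})"
proof -
  have "sym (offdiag_edges H)"
    using H_swap by (auto simp: sym_def offdiag_edges_def)
  then have "sym ((offdiag_edges H)\<^sup>*)" by (rule sym_rtrancl)
  then show ?thesis
    by (auto simp: equiv_def refl_on_def sym_def trans_def)
qed

lemma component_subset: "C \<in> components H \<Longrightarrow> C \<subseteq> {..<n}"
  by (auto simp: components_def quotient_def)

lemma component_nonempty: "C \<in> components H \<Longrightarrow> C \<noteq> {}"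
  unfolding components_def dim_H using equiv_reachability in_quotient_imp_non_empty by blast

lemma in_component: "i < n \<Longrightarrow> \<exists>C\<in>components H. i \<in> C"
  unfolding components_def dim_H using equiv_reachability Union_quotient by blast

lemma component_unique: "C \<in> components H \<Longrightarrow> C' \<in> components H \<Longrightarrow> i \<in> C \<Longrightarrow> i \<in> C' \<Longrightarrow> C = C'"
  unfolding components_def dim_H using equiv_reachability quotient_disj by blast

lemma component_closed:
  assumes "C \<in> components H" "i \<in> C" "(i, j) \<in> offdiag_edges H"
  shows "j \<in> C"
  using assms unfolding components_def quotient_def
  by (auto simp: offdiag_edges_def intro: rtrancl_into_rtrancl)

lemma scaled_A_outside_component:
  assumes "C \<in> components H" "i < n" "j < n" "i \<in> C \<longleftrightarrow> j \<notin> C"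
  shows "scaled_A H $$ (i, j) = 0"
  using component_closed[OF assms(1), of i j] component_closed[OF assms(1), of j i] assms
    H_swap[of i j]
  by (auto simp: scaled_A_entry offdiag_edges_def)

text \<open>A path from a point of \<open>Z\<close> to a point of \<open>C - Z\<close> has to leave \<open>Z\<close> along some edge, and that
  edge stays in \<open>C\<close>.\<close>

lemma component_irreducible:
  assumes C: "C \<in> components H" and Z: "Z \<subseteq> C" "Z \<noteq> {}" "Z \<noteq> C"
  shows "\<exists>i\<in>Z. \<exists>j\<in>C - Z. scaled_S H $$ (i, j) \<noteq> 0"
proof -
  obtain i j where i: "i \<in> Z" and j: "j \<in> C - Z" using Z by blast
  have "(i, j) \<in> (offdiag_edges H)\<^sup>* \<inter> {..<n} \<times> {..<n}"
    using C i j Z(1) quotient_eq_iff[OF equiv_reachability, of C C i j]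
    by (auto simp: components_def)
  then have path: "(i, j) \<in> (offdiag_edges H)\<^sup>*" by blast
  have "\<exists>k\<in>Z. \<exists>l. l \<notin> Z \<and> (k, l) \<in> offdiag_edges H"
  proof (rule ccontr)
    assume stay: "\<not> ?thesis"
    from path have "j \<in> Z"
      by (induction rule: rtrancl_induct) (use i stay in auto)
    then show False using j by simp
  qed
  then obtain k l where k: "k \<in> Z" and l: "l \<notin> Z" and e: "(k, l) \<in> offdiag_edges H" by blast
  have "l \<in> C" using component_closed[OF C _ e] k Z(1) by blast
  moreover have "scaled_S H $$ (k, l) \<noteq> 0"
    using e H_diag[of k] H_diag[of l] by (auto simp: offdiag_edges_def scaled_S_entry)
  ultimately show ?thesis using k l by blast
qed

section \<open>Optimality of the componentwise Perron vector\<close>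

lemma exists_component_eigenvector: "\<exists>v. component_eigenvector H v"
proof -
  let ?S = "scaled_S H"
  have "\<exists>x. (\<forall>i\<in>C. 0 < x i) \<and> (\<forall>i\<in>C. (\<Sum>j\<in>C. ?S $$ (i, j) * x j) =
      largest_eigenvalue (submatrix ?S C C) * x i)" if C: "C \<in> components H" for C
  proof -
    have lt: "i < n" if "i \<in> C" for i using that component_subset[OF C] by auto
    obtain x where "\<And>i. i \<in> C \<Longrightarrow> 0 < x i" "\<And>i. i \<in> C \<Longrightarrow>
        (\<Sum>j\<in>C. ?S $$ (i, j) * x j) = largest_eigenvalue (submatrix ?S C C) * x i"
    proof (rule irreducible_block_Perron[OF scaled_S_carrier component_subset[OF C]
          component_nonempty[OF C]])
      fix i j assume "i \<in> C" "j \<in> C"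
      then show "?S $$ (i, j) = ?S $$ (j, i)" "0 \<le> ?S $$ (i, j)"
        using lt H_swap H_diag by (auto simp: scaled_S_entry less_imp_le)
    qed (use component_irreducible[OF C] in blast)+
    then show ?thesis by blast
  qed
  then have "\<forall>C\<in>components H. \<exists>x. (\<forall>i\<in>C. 0 < x i) \<and> (\<forall>i\<in>C. (\<Sum>j\<in>C. ?S $$ (i, j) * x j) =
      largest_eigenvalue (submatrix ?S C C) * x i)" by blast
  from bchoice[OF this] obtain X where X: "\<forall>C\<in>components H.
      (\<forall>i\<in>C. 0 < X C i) \<and> (\<forall>i\<in>C. (\<Sum>j\<in>C. ?S $$ (i, j) * X C j) =
      largest_eigenvalue (submatrix ?S C C) * X C i)" ..
  have X0: "0 < X C i" if "C \<in> components H" "i \<in> C" for C i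
    by (rule bspec[OF conjunct1[OF bspec[OF X that(1)]] that(2)])
  have Xev: "(\<Sum>j\<in>C. ?S $$ (i, j) * X C j) = largest_eigenvalue (submatrix ?S C C) * X C i"
    if "C \<in> components H" "i \<in> C" for C i
    by (rule bspec[OF conjunct2[OF bspec[OF X that(1)]] that(2)])
  (* The components are pairwise disjoint, so each index reads its entry from the one component
     that contains it. *)
  define v where "v = vec n (\<lambda>i. X (THE C. C \<in> components H \<and> i \<in> C) i)"
  have vX: "v $ i = X C i" if "C \<in> components H" "i \<in> C" for C i
  proof -
    have "(THE C. C \<in> components H \<and> i \<in> C) = C"
      by (rule the_equality) (use that component_unique in blast)+
    moreover have "i < n" using that component_subset by blast
    ultimately show ?thesis by (simp add: v_def)
  qed
  have vc: "v \<in> carrier_vec n" by (simp add: v_def)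
  have "v \<in> pos_vecs n"
    using vc in_component vX X0 by (force simp: pos_vecs_def)
  moreover have "eigenvector (submatrix ?S C C) (subvector v C) (largest_eigenvalue (submatrix ?S C C))"
    if C: "C \<in> components H" for C
    unfolding eigenvector_submatrix_iff[OF scaled_S_carrier vc component_subset[OF C]]
  proof
    show "\<exists>i\<in>C. v $ i \<noteq> 0"
      using component_nonempty[OF C] X0[OF C] vX[OF C] by fastforce
    show "\<forall>i\<in>C. (\<Sum>j\<in>C. ?S $$ (i, j) * v $ j) =
        largest_eigenvalue (submatrix ?S C C) * v $ i"
    proof
      fix i assume i: "i \<in> C"
      have "(\<Sum>j\<in>C. ?S $$ (i, j) * v $ j) = (\<Sum>j\<in>C. ?S $$ (i, j) * X C j)"
        by (rule sum.cong[OF refl]) (simp only: vX[OF C])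
      also have "\<dots> = largest_eigenvalue (submatrix ?S C C) * v $ i"
        unfolding vX[OF C i] by (rule Xev[OF C i])
      finally show "(\<Sum>j\<in>C. ?S $$ (i, j) * v $ j) =
        largest_eigenvalue (submatrix ?S C C) * v $ i" .
    qed
  qed
  ultimately show ?thesis unfolding component_eigenvector_def dim_H by blast
qed

lemma diag_inv_sqrt_mult:
  assumes v: "v \<in> carrier_vec n"
  shows "diag_inv_sqrt H *\<^sub>v v = vec n (\<lambda>i. v $ i / sqrt (H $$ (i, i)))"
proof (rule eq_vecI)
  fix i assume "i < dim_vec (vec n (\<lambda>i. v $ i / sqrt (H $$ (i, i))))"
  then have i: "i < n" by simp
  have "(diag_inv_sqrt H *\<^sub>v v) $ i =
      (\<Sum>j\<in>{0..<n}. (if i = j then inverse (sqrt (H $$ (j, j))) else 0) * v $ j)"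
    using v i by (simp add: diag_inv_sqrt_def mat_diag_def scalar_prod_def)
  also have "\<dots> = (\<Sum>j\<in>{0..<n}. if i = j then inverse (sqrt (H $$ (j, j))) * v $ j else 0)"
    by (intro sum.cong) auto
  finally show "(diag_inv_sqrt H *\<^sub>v v) $ i = vec n (\<lambda>i. v $ i / sqrt (H $$ (i, i))) $ i"
    using i by (simp add: field_simps)
qed (simp add: diag_inv_sqrt_def mat_diag_def)

lemma scaled_A_mult_entry:
  assumes "w \<in> carrier_vec n" "i < n"
  shows "(scaled_A H *\<^sub>v w) $ i = (\<Sum>j<n. scaled_A H $$ (i, j) * w $ j)"
  using assms by (simp add: scalar_prod_def atLeast0LessThan)

lemma spectral_radius_le_theta:
  assumes w: "w \<in> pos_vecs n"
  shows "spectral_radius (map_mat complex_of_real (scaled_A H)) \<le> theta w H"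
proof (rule spectral_radius_le_Collatz_Wielandt[OF n_pos scaled_A_carrier _ w])
  fix i j assume "i < n" "j < n"
  then show "0 \<le> scaled_A H $$ (i, j)" using H_diag[of i] by (simp add: scaled_A_entry)
next
  fix i assume i: "i < n"
  then have "(scaled_A H *\<^sub>v w) $ i / w $ i \<le> theta w H"
    unfolding theta_def by (intro Max_ge) auto
  then show "(scaled_A H *\<^sub>v w) $ i \<le> theta w H * w $ i"
    using w i by (simp add: pos_vecs_def divide_le_eq)
qed

text \<open>Entrywise \<open>A = D\<^sup>-\<^sup>1\<^sup>/\<^sup>2 S D\<^sup>1\<^sup>/\<^sup>2\<close>, so \<open>w\<close> inherits the eigenvector equation of \<open>v\<close> on \<open>C\<close>. The vector
  \<open>u\<close> that agrees with \<open>w\<close> on \<open>C\<close> and is zero elsewhere satisfies it in all rows, because \<open>A\<close>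
  does not connect \<open>C\<close> with its complement.\<close>

lemma component_eigenvalue:
  assumes v: "component_eigenvector H v" and C: "C \<in> components H"
  defines "w \<equiv> diag_inv_sqrt H *\<^sub>v v"
    and "r \<equiv> largest_eigenvalue (submatrix (scaled_S H) C C)"
  shows "\<And>i. i \<in> C \<Longrightarrow> (scaled_A H *\<^sub>v w) $ i = r * w $ i"
    and "eigenvalue (scaled_A H) r"
proof -
  let ?A = "scaled_A H" and ?S = "scaled_S H"
  have vc: "v \<in> carrier_vec n" and vpos: "\<And>i. i < n \<Longrightarrow> 0 < v $ i"
    using v by (auto simp: component_eigenvector_def pos_vecs_def)
  have lt: "i < n" if "i \<in> C" for i using that component_subset[OF C] by auto
  have w: "w = vec n (\<lambda>i. v $ i / sqrt (H $$ (i, i)))"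
    unfolding w_def by (rule diag_inv_sqrt_mult[OF vc])
  have S: "(\<Sum>j\<in>C. ?S $$ (i, j) * v $ j) = r * v $ i" if "i \<in> C" for i
    using v C that eigenvector_submatrix_iff[OF scaled_S_carrier vc component_subset[OF C]]
    by (auto simp: component_eigenvector_def r_def)
  have restrict: "(\<Sum>j<n. ?A $$ (i, j) * f j) = (\<Sum>j\<in>C. ?A $$ (i, j) * f j)"
    if "i \<in> C" for i and f :: "nat \<Rightarrow> real"
    using scaled_A_outside_component[OF C, of i] that lt
    by (intro sum.mono_neutral_right) auto
  have row: "(\<Sum>j\<in>C. ?A $$ (i, j) * w $ j) = r * w $ i" if i: "i \<in> C" for i
  proof -
    have "(\<Sum>j\<in>C. ?A $$ (i, j) * w $ j) = (\<Sum>j\<in>C. ?S $$ (i, j) * v $ j / sqrt (H $$ (i, i)))"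
    proof (rule sum.cong[OF refl])
      fix j assume "j \<in> C"
      then show "?A $$ (i, j) * w $ j = ?S $$ (i, j) * v $ j / sqrt (H $$ (i, i))"
        using lt[OF i] lt[of j] H_diag[of j] by (simp add: w scaled_A_eq_scaled_S)
    qed
    also have "\<dots> = r * w $ i"
      using S[OF i] lt[OF i] by (simp add: w flip: sum_divide_distrib)
    finally show ?thesis .
  qed
  have wc: "w \<in> carrier_vec n" by (simp add: w)
  show "(?A *\<^sub>v w) $ i = r * w $ i" if "i \<in> C" for i
    using row[OF that] restrict[OF that] scaled_A_mult_entry[OF wc lt[OF that]] by simp
  define u where "u = vec n (\<lambda>i. if i \<in> C then w $ i else 0)"
  have uc: "u \<in> carrier_vec n" by (simp add: u_def)
  obtain c where c: "c \<in> C" using component_nonempty[OF C] by blast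
  have "u $ c \<noteq> 0"
    using c lt[OF c] vpos[OF lt[OF c]] H_diag[OF lt[OF c]] by (simp add: u_def w)
  then have "u \<noteq> 0\<^sub>v n" using lt[OF c] by auto
  moreover have "?A *\<^sub>v u = r \<cdot>\<^sub>v u"
  proof (rule eq_vecI)
    fix i assume "i < dim_vec (r \<cdot>\<^sub>v u)"
    then have i: "i < n" by (simp add: u_def)
    show "(?A *\<^sub>v u) $ i = (r \<cdot>\<^sub>v u) $ i"
    proof (cases "i \<in> C")
      case True
      have "(\<Sum>j\<in>C. ?A $$ (i, j) * u $ j) = (\<Sum>j\<in>C. ?A $$ (i, j) * w $ j)"
        using lt by (intro sum.cong) (auto simp: u_def)
      then show ?thesis
        using row[OF True] restrict[OF True] scaled_A_mult_entry[OF uc i] True i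
        by (simp add: u_def)
    next
      case False
      have "(\<Sum>j<n. ?A $$ (i, j) * u $ j) = 0"
        using scaled_A_outside_component[OF C i] False by (intro sum.neutral) (auto simp: u_def)
      then show ?thesis
        using scaled_A_mult_entry[OF uc i] False i by (simp add: u_def)
    qed
  qed (use uc in auto)
  ultimately show "eigenvalue ?A r"
    unfolding eigenvalue_def eigenvector_def using uc by auto
qed

text \<open>Each quotient in the definition of \<^const>\<open>theta\<close> is an eigenvalue of \<open>A\<close>, hence at most the
  spectral radius; the reverse inequality is the Collatz-Wielandt bound.\<close>

lemma component_eigenvector_theta:
  assumes v: "component_eigenvector H v"
  defines "w \<equiv> diag_inv_sqrt H *\<^sub>v v"
  shows "w \<in> pos_vecs n"
    and "theta w H = spectral_radius (map_mat complex_of_real (scaled_A H))"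
proof -
  have "v \<in> carrier_vec n" "\<And>i. i < n \<Longrightarrow> 0 < v $ i"
    using v by (auto simp: component_eigenvector_def pos_vecs_def)
  then show w: "w \<in> pos_vecs n"
    using H_diag by (simp add: w_def diag_inv_sqrt_mult pos_vecs_def)
  have "theta w H \<le> spectral_radius (map_mat complex_of_real (scaled_A H))"
    unfolding theta_def dim_H
  proof (intro Max.boundedI)
    fix q assume "q \<in> (\<lambda>i. (scaled_A H *\<^sub>v w) $ i / w $ i) ` {..<n}"
    then obtain i where i: "i < n" and q: "q = (scaled_A H *\<^sub>v w) $ i / w $ i" by auto
    obtain C where C: "C \<in> components H" "i \<in> C" using in_component[OF i] by blast
    have "w $ i \<noteq> 0" using w i by (auto simp: pos_vecs_def)
    then have "q = largest_eigenvalue (submatrix (scaled_S H) C C)"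
      using component_eigenvalue(1)[OF v C] by (simp add: q w_def)
    then show "q \<le> spectral_radius (map_mat complex_of_real (scaled_A H))"
      using component_eigenvalue(2)[OF v C(1)]
        eigenvalue_le_spectral_radius[OF scaled_A_carrier n_pos] by simp
  qed (use n_pos in auto)
  then show "theta w H = spectral_radius (map_mat complex_of_real (scaled_A H))"
    using spectral_radius_le_theta[OF w] by simp
qed

lemma component_eigenvector_arg_min:
  assumes "component_eigenvector H v"
  shows "is_arg_min (\<lambda>w. theta w H) (\<lambda>w. w \<in> pos_vecs n) (diag_inv_sqrt H *\<^sub>v v)"
  using component_eigenvector_theta[OF assms] spectral_radius_le_theta
  by (auto simp: is_arg_min_def not_less)

lemma theta_opt_eq: "theta_opt H = spectral_radius (map_mat complex_of_real (scaled_A H))"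
proof -
  obtain v where v: "component_eigenvector H v" using exists_component_eigenvector by blast
  show ?thesis
    unfolding theta_opt_def dim_H
    by (rule cInf_eq_minimum) (use component_eigenvector_theta[OF v] spectral_radius_le_theta in force)+
qed

end

theorem theorem4p2:
  fixes H :: "real mat" and n :: nat
  assumes "0 < n"
    and "H \<in> carrier_mat n n"
    and "transpose_mat H = H"
    and "\<And>i. i < n \<Longrightarrow> 0 < H $$ (i, i)"
  shows "theta_opt H = spectral_radius (map_mat complex_of_real (scaled_A H))
    \<and> (\<exists>w. is_arg_min (\<lambda>w. theta w H) (\<lambda>w. w \<in> pos_vecs n) w)
    \<and> transpose_mat (scaled_S H) = scaled_S H
    \<and> similar_mat (scaled_S H) (scaled_A H)
    \<and> (\<exists>v. component_eigenvector H v)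
    \<and> (\<forall>v. component_eigenvector H v \<longrightarrow>
          is_arg_min (\<lambda>w. theta w H) (\<lambda>w. w \<in> pos_vecs n) (diag_inv_sqrt H *\<^sub>v v))"
proof -
  interpret sym_pos_diag H n by standard (use assms in auto)
  show ?thesis
    using theta_opt_eq exists_component_eigenvector component_eigenvector_arg_min
      scaled_S_sym scaled_S_similar by blast
qed

end
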